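(* Let $\sigma\in\mathcal{S}_k$ and $\tau\in\mathcal{S}_n$ with $\sigma\le\tau$ in the pattern poset $\mathcal{P}$. If the pair $(\sigma,\tau)$ has an interval block, then $\mu(\sigma,\tau)=0$, where $\mu$ is the Möbius function of $\mathcal{P}$.
   Context: $\mathcal{P}$ is the poset of all permutations (of $\{1,\dots,m\}$ for all $m\ge1$) ordered by pattern containment: $\sigma\le\tau$ if some subsequence $\tau(i_1)\cdots\tau(i_k)$ ($i_1<\dots<i_k$) is order isomorphic to $\sigma$ (has letters in the same relative order of size); such a subsequence is an occurrence of $\sigma$ in $\tau$. An interval block of $\tau$ is a factor (consecutive substring) $\tau(a)\tau(a+1)\cdots\tau(a+b)$ with $b\ge1$ whose set of values is $\{a',a'+1,\dots,a'+b\}$ for some $a'$. The pair $(\sigma,\tau)$ has an interval block if $\tau$ has an interval block that is disjoint from (shares no letter with) every occurrence of $\sigma$ in $\tau$. The Möbius function is defined by $\mu(s,s)=1$ and $\mu(s,t)=-\sum_{s\le x<t}\mu(s,x)$ for $s<t$. *)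

theory Defs
  imports "HOL-Combinatorics.Multiset_Permutations"
begin

text \<open>
  A permutation of \<open>{1..n}\<close> is its one-line word \<open>\<tau>(1)\<cdots>\<tau>(n)\<close>, as a list; positions in the list
  are counted from 0, so that \<open>\<tau> ! i\<close> is the letter \<open>\<tau>(i + 1)\<close>.
\<close>

abbreviation perms_of_size :: "nat \<Rightarrow> nat list set" where
  "perms_of_size n \<equiv> permutations_of_set {1..n}"

definition perms :: "nat list set" where
  "perms = (\<Union>n\<in>{1..}. perms_of_size n)"

definition order_isomorphic :: "nat list \<Rightarrow> nat list \<Rightarrow> bool" where
  "order_isomorphic us vs \<longleftrightarrow>
     length us = length vs \<and>
     (\<forall>i<length us. \<forall>j<length us. us ! i < us ! j \<longleftrightarrow> vs ! i < vs ! j)"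

text \<open>A subsequence of \<open>\<tau>\<close> is given by its set \<open>I\<close> of positions; its word is \<open>nths \<tau> I\<close>.\<close>

definition occurrence :: "nat list \<Rightarrow> nat list \<Rightarrow> nat set \<Rightarrow> bool" where
  "occurrence \<sigma> \<tau> I \<longleftrightarrow> I \<subseteq> {..<length \<tau>} \<and> order_isomorphic (nths \<tau> I) \<sigma>"

definition pattern_le :: "nat list \<Rightarrow> nat list \<Rightarrow> bool"  (infix "\<le>\<^sub>p" 50) where
  "\<sigma> \<le>\<^sub>p \<tau> \<longleftrightarrow> \<sigma> \<in> perms \<and> \<tau> \<in> perms \<and> (\<exists>I. occurrence \<sigma> \<tau> I)"

definition pattern_less :: "nat list \<Rightarrow> nat list \<Rightarrow> bool"  (infix "<\<^sub>p" 50) where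
  "\<sigma> <\<^sub>p \<tau> \<longleftrightarrow> \<sigma> \<le>\<^sub>p \<tau> \<and> \<sigma> \<noteq> \<tau>"

text \<open>\<open>B\<close> is the set of positions of the block.\<close>

definition interval_block :: "nat list \<Rightarrow> nat set \<Rightarrow> bool" where
  "interval_block \<tau> B \<longleftrightarrow>
     (\<exists>a b. b \<ge> 1 \<and> a + b < length \<tau> \<and> B = {a..a + b} \<and>
        (\<exists>a'. (!) \<tau> ` B = {a'..a' + b}))"

definition has_interval_block :: "nat list \<Rightarrow> nat list \<Rightarrow> bool" where
  "has_interval_block \<sigma> \<tau> \<longleftrightarrow>
     (\<exists>B. interval_block \<tau> B \<and> (\<forall>I. occurrence \<sigma> \<tau> I \<longrightarrow> B \<inter> I = {}))"


lemma permsE: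
  assumes "\<sigma> \<in> perms"
  shows "length \<sigma> \<ge> 1" "distinct \<sigma>" "set \<sigma> = {1..length \<sigma>}"
proof -
  from assms obtain n where n: "n \<ge> 1" "set \<sigma> = {1..n}" "distinct \<sigma>"
    unfolding perms_def permutations_of_set_def by auto
  then have "length \<sigma> = n" using distinct_card[of \<sigma>] by simp
  with n show "length \<sigma> \<ge> 1" "distinct \<sigma>" "set \<sigma> = {1..length \<sigma>}" by auto
qed

lemma perms_nth_rank:
  assumes "\<sigma> \<in> perms" "i < length \<sigma>"
  shows "\<sigma> ! i = Suc (card {j. j < length \<sigma> \<and> \<sigma> ! j < \<sigma> ! i})"
proof -
  let ?J = "{j. j < length \<sigma> \<and> \<sigma> ! j < \<sigma> ! i}"
  note p = permsE[OF assms(1)]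
  have r: "1 \<le> \<sigma> ! i" "\<sigma> ! i \<le> length \<sigma>"
    using p(3) nth_mem[OF assms(2)] by auto
  have "(!) \<sigma> ` ?J = {1..<\<sigma> ! i}"
  proof
    show "(!) \<sigma> ` ?J \<subseteq> {1..<\<sigma> ! i}"
    proof
      fix v assume "v \<in> (!) \<sigma> ` ?J"
      then obtain j where j: "j < length \<sigma>" "v < \<sigma> ! i" "v = \<sigma> ! j" by auto
      then have "v \<in> {1..length \<sigma>}" using p(3) nth_mem by metis
      with j show "v \<in> {1..<\<sigma> ! i}" by simp
    qed
    show "{1..<\<sigma> ! i} \<subseteq> (!) \<sigma> ` ?J"
    proof
      fix v assume v: "v \<in> {1..<\<sigma> ! i}"
      then have "v \<in> set \<sigma>" using p(3) r by simp
      then obtain j where "j < length \<sigma>" "\<sigma> ! j = v" by (auto simp: in_set_conv_nth)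
      with v show "v \<in> (!) \<sigma> ` ?J" by auto
    qed
  qed
  moreover have "inj_on ((!) \<sigma>) ?J"
    using p(2) by (auto simp: inj_on_def nth_eq_iff_index_eq)
  ultimately have "card ?J = card {1..<\<sigma> ! i}" using card_image by metis
  with r show ?thesis by simp
qed

lemma order_isomorphic_perms_eq:
  assumes "\<sigma> \<in> perms" "\<tau> \<in> perms" "order_isomorphic \<sigma> \<tau>"
  shows "\<sigma> = \<tau>"
proof (rule nth_equalityI)
  show l: "length \<sigma> = length \<tau>" using assms(3) by (simp add: order_isomorphic_def)
  fix i assume i: "i < length \<sigma>"
  have "{j. j < length \<sigma> \<and> \<sigma> ! j < \<sigma> ! i} = {j. j < length \<tau> \<and> \<tau> ! j < \<tau> ! i}"
    using assms(3) i by (auto simp: order_isomorphic_def)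
  then show "\<sigma> ! i = \<tau> ! i"
    using perms_nth_rank[OF assms(1) i] perms_nth_rank[OF assms(2)] i l by simp
qed

lemma occurrence_card:
  assumes "occurrence \<sigma> \<tau> I"
  shows "card I = length \<sigma>"
proof -
  have "{i. i < length \<tau> \<and> i \<in> I} = I" using assms by (auto simp: occurrence_def)
  then show ?thesis
    using assms by (auto simp: occurrence_def order_isomorphic_def length_nths)
qed

lemma pattern_le_length: "\<sigma> \<le>\<^sub>p \<tau> \<Longrightarrow> length \<sigma> \<le> length \<tau>"
  unfolding pattern_le_def
  by (metis occurrence_card occurrence_def card_lessThan card_mono finite_lessThan)

lemma pattern_less_length:
  assumes "\<sigma> <\<^sub>p \<tau>"
  shows "length \<sigma> < length \<tau>"
proof (rule ccontr)
  assume "\<not> length \<sigma> < length \<tau>"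
  with assms have l: "length \<sigma> = length \<tau>"
    using pattern_le_length by (force simp: pattern_less_def)
  from assms obtain I where I: "occurrence \<sigma> \<tau> I" and p: "\<sigma> \<in> perms" "\<tau> \<in> perms" "\<sigma> \<noteq> \<tau>"
    by (auto simp: pattern_less_def pattern_le_def)
  have "I = {..<length \<tau>}"
    using I l occurrence_card[OF I] by (intro card_subset_eq) (auto simp: occurrence_def)
  then have "nths \<tau> I = \<tau>" by (simp add: nths_all)
  then have "order_isomorphic \<tau> \<sigma>" using I by (simp add: occurrence_def)
  with p show False using order_isomorphic_perms_eq by metis
qed

lemma pattern_le_refl: "\<sigma> \<in> perms \<Longrightarrow> \<sigma> \<le>\<^sub>p \<sigma>"
  unfolding pattern_le_def occurrence_def order_isomorphic_def
  by (auto intro!: exI[of _ "{..<length \<sigma>}"] simp: nths_all)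

lemma pattern_le_antisym: "\<sigma> \<le>\<^sub>p \<tau> \<Longrightarrow> \<tau> \<le>\<^sub>p \<sigma> \<Longrightarrow> \<sigma> = \<tau>"
  using pattern_less_length pattern_less_def by (metis less_asym)

lemma nths_conv_map_nth: "nths xs I = map ((!) xs) (filter (\<lambda>i. i \<in> I) [0..<length xs])"
proof (induction xs rule: rev_induct)
  case (snoc x xs)
  have "map ((!) (xs @ [x])) (filter (\<lambda>i. i \<in> I) [0..<length xs])
      = map ((!) xs) (filter (\<lambda>i. i \<in> I) [0..<length xs])"
    by (rule map_cong) (auto simp: nth_append)
  with snoc show ?case by (simp add: nths_append nths_singleton)
qed simp

lemma order_isomorphic_nths:
  assumes "order_isomorphic us vs"
  shows "order_isomorphic (nths us I) (nths vs I)"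
proof -
  let ?f = "filter (\<lambda>i. i \<in> I) [0..<length us]"
  have l: "length vs = length us" using assms by (simp add: order_isomorphic_def)
  have b: "?f ! i < length us" if "i < length ?f" for i
    using nth_mem[OF that] by auto
  have "nths us I = map ((!) us) ?f" "nths vs I = map ((!) vs) ?f"
    by (simp_all only: nths_conv_map_nth l)
  then show ?thesis
    using assms b by (simp add: order_isomorphic_def)
qed

lemma order_isomorphic_trans:
  "order_isomorphic us vs \<Longrightarrow> order_isomorphic vs ws \<Longrightarrow> order_isomorphic us ws"
  unfolding order_isomorphic_def by auto

lemma pattern_le_trans:
  assumes "\<sigma> \<le>\<^sub>p \<rho>" "\<rho> \<le>\<^sub>p \<tau>"
  shows "\<sigma> \<le>\<^sub>p \<tau>"
proof -
  from assms obtain I J where I: "order_isomorphic (nths \<rho> I) \<sigma>"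
    and J: "order_isomorphic (nths \<tau> J) \<rho>" and p: "\<sigma> \<in> perms" "\<tau> \<in> perms"
    by (auto simp: pattern_le_def occurrence_def)
  have o: "order_isomorphic (nths (nths \<tau> J) I) \<sigma>"
    using order_isomorphic_trans[OF order_isomorphic_nths[OF J] I] .
  obtain K where K: "nths (nths \<tau> J) I = nths \<tau> K"
    using nths_nths by metis
  have "nths \<tau> K = nths \<tau> (K \<inter> {..<length \<tau>})"
    unfolding nths_conv_map_nth
    by (intro arg_cong[where f = "map ((!) \<tau>)"] filter_cong) auto
  with o K have "occurrence \<sigma> \<tau> (K \<inter> {..<length \<tau>})"
    by (simp add: occurrence_def)
  with p show ?thesis unfolding pattern_le_def by blast
qed

text \<open>The sum defining the Moebius function below is finite, hence not silently zero.\<close>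

lemma finite_pattern_downset: "finite {\<rho>. \<rho> \<le>\<^sub>p \<tau>}"
proof (rule finite_subset)
  show "{\<rho>. \<rho> \<le>\<^sub>p \<tau>} \<subseteq> (\<Union>n\<le>length \<tau>. perms_of_size n)"
  proof
    fix \<rho> assume "\<rho> \<in> {\<rho>. \<rho> \<le>\<^sub>p \<tau>}"
    then have "\<rho> \<in> perms" "length \<rho> \<le> length \<tau>"
      using pattern_le_length by (auto simp: pattern_le_def)
    with permsE[of \<rho>] show "\<rho> \<in> (\<Union>n\<le>length \<tau>. perms_of_size n)"
      by (intro UN_I[of "length \<rho>"]) (auto simp: permutations_of_set_def)
  qed
qed auto

function mobius :: "nat list \<Rightarrow> nat list \<Rightarrow> int" where
  "mobius \<sigma> \<tau> =
     (if \<sigma> = \<tau> then 1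
      else if \<sigma> <\<^sub>p \<tau> then - (\<Sum>\<rho>\<in>{\<rho>. \<sigma> \<le>\<^sub>p \<rho> \<and> \<rho> <\<^sub>p \<tau>}. mobius \<sigma> \<rho>)
      else 0)"
  by pat_completeness auto
termination
  by (relation "measure (\<lambda>(\<sigma>, \<tau>). length \<tau>)") (auto simp: pattern_less_length)

declare mobius.simps [simp del]

end

theory Submission
  imports Defs
begin

text \<open>
  Induction on the length of \<open>\<tau>\<close>. Let \<open>B\<close> be the block and let \<open>\<tau>'\<close> be \<open>\<tau>\<close> with \<open>B\<close> collapsed to a
  single letter. If some \<open>\<rho>\<close> with \<open>\<sigma> \<le> \<rho> < \<tau>\<close> has an occurrence with at least two letters in \<open>B\<close>,
  then these letters form an interval block of \<open>(\<sigma>, \<rho>)\<close>, so \<open>\<mu>(\<sigma>, \<rho>) = 0\<close> by induction. Every other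
  \<open>\<rho>\<close> lies below \<open>\<tau>'\<close>. Hence \<open>\<mu>(\<sigma>, \<tau>)\<close> is minus the sum of \<open>\<mu>(\<sigma>, \<rho>)\<close> over \<open>\<sigma> \<le> \<rho> \<le> \<tau>'\<close>, and
  this sum vanishes because \<open>\<sigma> \<noteq> \<tau>'\<close>: the occurrence of \<open>\<tau>'\<close> meets \<open>B\<close>.
\<close>

section \<open>Occurrences as maps between positions\<close>

text \<open>Occurrences become maps so that they can be composed, factored and altered at one
  position, which is awkward for position sets and \<open>nths\<close>. Values of \<open>e\<close>
  beyond the length of \<open>us\<close> are arbitrary.\<close>

definition embeds :: "nat list \<Rightarrow> nat list \<Rightarrow> (nat \<Rightarrow> nat) \<Rightarrow> bool" where
  "embeds us vs e \<longleftrightarrow>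
     strict_mono_on {..<length us} e \<and> e ` {..<length us} \<subseteq> {..<length vs} \<and>
     (\<forall>i<length us. \<forall>j<length us. us ! i < us ! j \<longleftrightarrow> vs ! e i < vs ! e j)"

lemma filter_upt_strict_mono_image:
  assumes "strict_mono_on {..<m} e" "e ` {..<m} \<subseteq> {..<n}"
  shows "filter (\<lambda>i. i \<in> e ` {..<m}) [0..<n] = map e [0..<m]"
proof (rule strict_sorted_equal)
  show "sorted_wrt (<) (filter (\<lambda>i. i \<in> e ` {..<m}) [0..<n])"
    by (intro sorted_wrt_filter) simp
  show "sorted_wrt (<) (map e [0..<m])"
    using assms(1) by (auto simp: sorted_wrt_iff_nth_less strict_mono_on_def)
  show "set (filter (\<lambda>i. i \<in> e ` {..<m}) [0..<n]) = set (map e [0..<m])"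
    using assms(2) by (auto simp: lessThan_atLeast0)
qed

lemma occurrence_iff_embeds:
  "occurrence us vs I \<longleftrightarrow> (\<exists>e. embeds us vs e \<and> I = e ` {..<length us})"
proof
  assume o: "occurrence us vs I"
  \<comment> \<open>The embedding is the increasing enumeration of \<open>I\<close>.\<close>
  define f where "f = filter (\<lambda>i. i \<in> I) [0..<length vs]"
  have n: "nths vs I = map ((!) vs) f" by (simp add: f_def nths_conv_map_nth)
  have l: "length f = length us"
    using o n by (auto simp: occurrence_def order_isomorphic_def)
  have "sorted_wrt (<) f" unfolding f_def by (intro sorted_wrt_filter) simp
  then have "strict_mono_on {..<length us} ((!) f)"
    using l by (auto simp: strict_mono_on_def sorted_wrt_iff_nth_less)
  moreover have s: "(!) f ` {..<length us} = I"
  proof -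
    have "(!) f ` {..<length us} = set f"
      using l by (auto simp: set_conv_nth)
    also have "\<dots> = I" using o by (auto simp: f_def occurrence_def)
    finally show ?thesis .
  qed
  ultimately have "embeds us vs ((!) f)"
    using o l n by (auto simp: embeds_def occurrence_def order_isomorphic_def)
  with s show "\<exists>e. embeds us vs e \<and> I = e ` {..<length us}" by blast
next
  assume "\<exists>e. embeds us vs e \<and> I = e ` {..<length us}"
  then obtain e where e: "embeds us vs e" and I: "I = e ` {..<length us}" by blast
  then have "nths vs I = map ((!) vs) (map e [0..<length us])"
    unfolding nths_conv_map_nth I embeds_def
    by (subst filter_upt_strict_mono_image) auto
  then show "occurrence us vs I"
    using e I by (auto simp: occurrence_def order_isomorphic_def embeds_def)
qed

lemma embeds_comp:
  assumes "embeds us vs e" "embeds vs ws f"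
  shows "embeds us ws (f \<circ> e)"
proof -
  have "e i < length vs" if "i < length us" for i
    using assms(1) that by (auto simp: embeds_def)
  with assms show ?thesis
    by (auto simp: embeds_def strict_mono_on_def image_subset_iff)
qed

text \<open>The map \<open>h\<close> is \<open>e\<close> followed by the inverse of \<open>f\<close>
  on its image; a strictly increasing \<open>f\<close> also reflects the order of positions.\<close>

lemma embeds_factor:
  assumes e: "embeds us ws e" and f: "embeds vs ws f"
    and sub: "e ` {..<length us} \<subseteq> f ` {..<length vs}"
  obtains h where "embeds us vs h"
proof -
  have "\<forall>i\<in>{..<length us}. \<exists>j<length vs. e i = f j" using sub by (auto simp: image_iff)
  then obtain h where h: "\<And>i. i < length us \<Longrightarrow> h i < length vs \<and> e i = f (h i)"
    by (metis lessThan_iff)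
  have "h i < h j" if "i < j" "j < length us" for i j
  proof -
    have "f (h i) < f (h j)" using e h that by (force simp: embeds_def strict_mono_on_def)
    moreover have "h i < length vs" "h j < length vs" using h that by auto
    ultimately show ?thesis
      using f strict_mono_on_less by (auto simp: embeds_def)
  qed
  then have "embeds us vs h"
    using e f h by (auto simp: embeds_def strict_mono_on_def)
  then show thesis by (rule that)
qed

section \<open>Standardization and intervals of natural numbers\<close>

lemma exists_standardization:
  assumes "distinct us" "us \<noteq> []"
  obtains \<pi> where "\<pi> \<in> perms" "order_isomorphic us \<pi>"
proof -
  \<comment> \<open>The rank of \<open>x\<close> counts \<open>x\<close> itself, so ranks of letters
    start at 1.\<close>
  define r where "r x = card {y \<in> set us. y \<le> x}" for x
  define \<pi> where "\<pi> = map r us"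
  have mono: "r x < r y" if "x < y" "y \<in> set us" for x y
    unfolding r_def using that by (intro psubset_card_mono) (auto, force)
  then have iff: "r x < r y \<longleftrightarrow> x < y" if "x \<in> set us" "y \<in> set us" for x y
    using that by (metis less_asym less_irrefl nat_neq_iff)
  have inj: "inj_on r (set us)"
    using iff by (metis inj_onI less_irrefl nat_neq_iff)
  have "r x \<in> {1..length us}" if "x \<in> set us" for x
  proof -
    have "card {x} \<le> r x" unfolding r_def using that by (intro card_mono) auto
    moreover have "r x \<le> card (set us)" unfolding r_def by (intro card_mono) auto
    ultimately show ?thesis using assms(1) by (simp add: distinct_card)
  qed
  then have "r ` set us = {1..length us}"
    using assms(1) inj by (intro card_subset_eq) (auto simp: card_image distinct_card)
  moreover have "distinct \<pi>" using assms(1) inj by (simp add: \<pi>_def distinct_map)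
  ultimately have "\<pi> \<in> perms"
    using assms(2)
    by (auto simp: perms_def permutations_of_set_def \<pi>_def Suc_le_eq
        intro!: bexI[of _ "length us"])
  moreover have "order_isomorphic us \<pi>"
    using iff by (simp add: order_isomorphic_def \<pi>_def)
  ultimately show thesis by (rule that)
qed

text \<open>Serves for both the positions and the values of a block; the form of the right end
  matches \<open>interval_block\<close>, where \<open>b\<close> is one less than the number of
  letters.\<close>

lemma convex_nat_set_eq_interval:
  fixes S :: "nat set"
  assumes "finite S" "S \<noteq> {}"
    and convex: "\<And>u v w. \<lbrakk>u \<in> S; w \<in> S; u < v; v < w\<rbrakk> \<Longrightarrow> v \<in> S"
  obtains a where "S = {a..a + (card S - 1)}"
proof -
  have S: "S = {Min S..Max S}"
  proof
    show "{Min S..Max S} \<subseteq> S"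
      using convex[OF Min_in[OF assms(1,2)] Max_in[OF assms(1,2)]]
        Min_in[OF assms(1,2)] Max_in[OF assms(1,2)]
      by (auto simp: le_less)
  qed (use assms(1) in auto)
  have "Min S \<le> Max S" using assms(1,2) by simp
  moreover have "card S = Suc (Max S) - Min S" by (subst S) simp
  ultimately have "Max S = Min S + (card S - 1)" by simp
  with S have "S = {Min S..Min S + (card S - 1)}" by metis
  then show thesis by (rule that)
qed

section \<open>Interval blocks under embeddings\<close>

text \<open>Positions and values of the preimage are convex because \<open>e\<close> preserves both
  orders and \<open>B\<close> is an interval in both. Two letters in \<open>B\<close> make the
  preimage long enough for a block.\<close>

lemma interval_block_preimage:
  assumes \<rho>: "\<rho> \<in> perms" and \<tau>: "distinct \<tau>"
    and e: "embeds \<rho> \<tau> e" and B: "interval_block \<tau> B"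
    and two: "i\<^sub>1 < length \<rho>" "i\<^sub>2 < length \<rho>" "i\<^sub>1 \<noteq> i\<^sub>2" "e i\<^sub>1 \<in> B" "e i\<^sub>2 \<in> B"
  shows "interval_block \<rho> {i. i < length \<rho> \<and> e i \<in> B}"
proof -
  let ?C = "{i. i < length \<rho> \<and> e i \<in> B}"
  from B obtain a b a' where Beq: "B = {a..a + b}" and ab: "a + b < length \<tau>"
    and img: "(!) \<tau> ` B = {a'..a' + b}"
    unfolding interval_block_def by blast
  have ne: "?C \<noteq> {}" using two by blast
  have two': "2 \<le> card ?C"
    using two card_mono[of ?C "{i\<^sub>1, i\<^sub>2}"] by auto
  have lt: "e i < length \<tau>" if "i < length \<rho>" for i
    using e that by (auto simp: embeds_def)
  have mem: "p \<in> B" if "\<tau> ! p \<in> (!) \<tau> ` B" "p < length \<tau>" for p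
    using that \<tau> ab Beq by (auto simp: nth_eq_iff_index_eq)
  obtain c where c: "?C = {c..c + (card ?C - 1)}"
  proof (rule convex_nat_set_eq_interval[OF _ ne])
    fix u v w assume "u \<in> ?C" "w \<in> ?C" "u < v" "v < w"
    moreover from this have "e u < e v" "e v < e w"
      using e by (auto simp: embeds_def strict_mono_on_def)
    ultimately show "v \<in> ?C" unfolding Beq by auto
  qed auto
  have inj: "inj_on ((!) \<rho>) ?C"
    using permsE(2)[OF \<rho>] by (auto simp: inj_on_def nth_eq_iff_index_eq)
  obtain c' where c': "(!) \<rho> ` ?C = {c'..c' + (card ((!) \<rho> ` ?C) - 1)}"
  proof (rule convex_nat_set_eq_interval)
    fix u v w assume "u \<in> (!) \<rho> ` ?C" and "w \<in> (!) \<rho> ` ?C" and o: "u < v" "v < w"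
    then obtain i j where i: "i \<in> ?C" "u = \<rho> ! i" and j: "j \<in> ?C" "w = \<rho> ! j" by blast
    have "u \<in> set \<rho>" "w \<in> set \<rho>" using i j by auto
    \<comment> \<open>A permutation skips no value, so the intermediate \<open>v\<close> really is a
      letter of \<rho>.\<close>
    then have "v \<in> set \<rho>" using o permsE(3)[OF \<rho>] by auto
    then obtain k where k: "k < length \<rho>" "v = \<rho> ! k" by (auto simp: in_set_conv_nth)
    have "\<tau> ! e i < \<tau> ! e k" "\<tau> ! e k < \<tau> ! e j"
      using e i j k o by (auto simp: embeds_def)
    moreover have "\<tau> ! e i \<in> {a'..a' + b}" "\<tau> ! e j \<in> {a'..a' + b}"
      using i j img by blast+
    ultimately have "e k \<in> B" using k lt by (intro mem) (auto simp: img)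
    with k show "v \<in> (!) \<rho> ` ?C" by blast
  qed (use ne in auto)
  have "c + (card ?C - 1) \<in> ?C" by (subst (2) c) simp
  then have "c + (card ?C - 1) < length \<rho>" by simp
  with c c' two' show ?thesis
    unfolding interval_block_def card_image[OF inj]
    by (intro exI[of _ c] exI[of _ "card ?C - 1"]) auto
qed

text \<open>An occurrence of \<sigma> in \<rho> meeting the preimage would be carried by
  \<open>e\<close> to one in \<tau> meeting \<open>B\<close>.\<close>

lemma has_interval_block_preimage:
  assumes "\<rho> \<in> perms" "distinct \<tau>" and e: "embeds \<rho> \<tau> e" and "interval_block \<tau> B"
    and disj: "\<And>I. occurrence \<sigma> \<tau> I \<Longrightarrow> B \<inter> I = {}"
    and "i\<^sub>1 < length \<rho>" "i\<^sub>2 < length \<rho>" "i\<^sub>1 \<noteq> i\<^sub>2" "e i\<^sub>1 \<in> B" "e i\<^sub>2 \<in> B"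
  shows "has_interval_block \<sigma> \<rho>"
  unfolding has_interval_block_def
proof (intro exI conjI allI impI)
  show "interval_block \<rho> {i. i < length \<rho> \<and> e i \<in> B}"
    using assms by (intro interval_block_preimage)
  fix I assume "occurrence \<sigma> \<rho> I"
  then obtain f where f: "embeds \<sigma> \<rho> f" "I = f ` {..<length \<sigma>}"
    unfolding occurrence_iff_embeds by blast
  then have "occurrence \<sigma> \<tau> (e ` I)"
    unfolding occurrence_iff_embeds using embeds_comp[OF f(1) e] by (auto simp: image_comp)
  from disj[OF this] show "{i. i < length \<rho> \<and> e i \<in> B} \<inter> I = {}" by blast
qed

text \<open>A letter outside the block compares in the same way with all letters of the block, in
  position and in value. Hence a lone letter in \<open>B\<close> may be moved to the first position
  of the block.\<close>

lemma embeds_move_into_block: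
  assumes e: "embeds us \<tau> e" and "distinct \<tau>"
    and Beq: "B = {a..a + b}" and ab: "a + b < length \<tau>"
    and img: "(!) \<tau> ` B = {a'..a' + b}"
    and one: "\<And>i j. \<lbrakk>i < length us; j < length us; e i \<in> B; e j \<in> B\<rbrakk> \<Longrightarrow> i = j"
  shows "embeds us \<tau> (\<lambda>i. if e i \<in> B then a else e i)"
proof -
  let ?g = "\<lambda>i. if e i \<in> B then a else e i"
  have lt: "e i < length \<tau>" if "i < length us" for i
    using e that by (auto simp: embeds_def)
  have inB: "\<tau> ! p \<in> {a'..a' + b}" if "p \<in> B" for p using that img by blast
  have notB: "\<tau> ! p \<notin> {a'..a' + b}" if "p \<notin> B" "p < length \<tau>" for p
  proof
    assume "\<tau> ! p \<in> {a'..a' + b}"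
    then obtain q where "q \<in> B" "\<tau> ! p = \<tau> ! q" unfolding img[symmetric] by blast
    with that show False using assms(2) Beq ab by (auto simp: nth_eq_iff_index_eq)
  qed
  have aB: "a \<in> B" by (simp add: Beq)
  have pos: "?g i < ?g j" if "i < j" "j < length us" for i j
  proof -
    have "e i < e j" using e that by (auto simp: embeds_def strict_mono_on_def)
    moreover have "\<not> (e i \<in> B \<and> e j \<in> B)" using one[of i j] that by auto
    ultimately show ?thesis by (auto simp: Beq)
  qed
  have val: "us ! i < us ! j \<longleftrightarrow> \<tau> ! ?g i < \<tau> ! ?g j"
    if ij: "i < length us" "j < length us" for i j
  proof -
    have eq: "us ! i < us ! j \<longleftrightarrow> \<tau> ! e i < \<tau> ! e j" using e ij by (auto simp: embeds_def)
    consider "i = j" | "e i \<notin> B" "e j \<notin> B" | "e i \<in> B" "e j \<notin> B" | "e i \<notin> B" "e j \<in> B"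
      using one[OF ij] by blast
    then show ?thesis
    proof cases
      case 3
      with inB[OF aB] inB[of "e i"] notB[OF _ lt[OF ij(2)]] show ?thesis
        unfolding eq by auto
    next
      case 4
      with inB[OF aB] inB[of "e j"] notB[OF _ lt[OF ij(1)]] show ?thesis
        unfolding eq by auto
    qed (use eq in auto)
  qed
  show ?thesis
    unfolding embeds_def
  proof (intro conjI allI impI)
    show "strict_mono_on {..<length us} ?g"
      using pos by (intro strict_mono_onI) blast
    show "?g ` {..<length us} \<subseteq> {..<length \<tau>}"
      using lt ab by auto
  qed (use val in blast)
qed

section \<open>Vanishing of the Moebius function\<close>

lemma sum_mobius_eq_0:
  assumes "\<sigma> <\<^sub>p \<tau>"
  shows "(\<Sum>\<rho>\<in>{\<rho>. \<sigma> \<le>\<^sub>p \<rho> \<and> \<rho> \<le>\<^sub>p \<tau>}. mobius \<sigma> \<rho>) = 0"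
proof -
  let ?S = "{\<rho>. \<sigma> \<le>\<^sub>p \<rho> \<and> \<rho> <\<^sub>p \<tau>}"
  have "finite ?S"
    by (rule finite_subset[OF _ finite_pattern_downset[of \<tau>]]) (auto simp: pattern_less_def)
  moreover have "{\<rho>. \<sigma> \<le>\<^sub>p \<rho> \<and> \<rho> \<le>\<^sub>p \<tau>} = insert \<tau> ?S" "\<tau> \<notin> ?S"
    using assms pattern_le_refl[of \<tau>] by (auto simp: pattern_less_def pattern_le_def[of \<sigma> \<tau>])
  ultimately show ?thesis
    using assms by (simp add: mobius.simps[of \<sigma> \<tau>] pattern_less_def)
qed

text \<open>Keeping one letter of \<open>B\<close> suffices for every \<rho> that uses at most one:
  its embedding is moved to that letter and then factors through \<tau>'.\<close>

lemma collapse_block: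
  assumes \<tau>: "\<tau> \<in> perms" and B: "interval_block \<tau> B"
  obtains \<tau>' J where "\<tau>' <\<^sub>p \<tau>" "occurrence \<tau>' \<tau> J" "B \<inter> J \<noteq> {}"
    "\<And>\<rho> e. \<lbrakk>\<rho> \<in> perms; embeds \<rho> \<tau> e;
        \<And>i j. \<lbrakk>i < length \<rho>; j < length \<rho>; e i \<in> B; e j \<in> B\<rbrakk> \<Longrightarrow> i = j\<rbrakk> \<Longrightarrow> \<rho> \<le>\<^sub>p \<tau>'"
proof -
  from B obtain a b a' where b: "b \<ge> 1" and Beq: "B = {a..a + b}" and ab: "a + b < length \<tau>"
    and img: "(!) \<tau> ` B = {a'..a' + b}"
    unfolding interval_block_def by blast
  note d = permsE(2)[OF \<tau>]
  \<comment> \<open>Only the first letter of the block survives.\<close>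
  define J where "J = {..<length \<tau>} - (B - {a})"
  have aJ: "a \<in> J" using ab by (simp add: J_def)
  have "\<tau> ! a \<in> set (nths \<tau> J)" using aJ ab by (auto simp: set_nths)
  then have "nths \<tau> J \<noteq> []" by auto
  with distinct_nthsI[OF d] obtain \<tau>' where \<tau>': "\<tau>' \<in> perms"
    and oi: "order_isomorphic (nths \<tau> J) \<tau>'"
    by (rule exists_standardization)
  have occ: "occurrence \<tau>' \<tau> J"
    using oi by (auto simp: occurrence_def J_def)
  \<comment> \<open>Since \<open>b\<close> is at least 1, a letter is really deleted, which makes
    \<tau>' strictly smaller.\<close>
  have "a + b \<notin> J" using b by (simp add: J_def Beq)
  moreover have "J \<subseteq> {..<length \<tau>}" unfolding J_def by blast
  ultimately have "card J < card {..<length \<tau>}"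
    using ab by (intro psubset_card_mono finite_lessThan) blast
  then have "length \<tau>' < length \<tau>" using occurrence_card[OF occ] by simp
  then have less: "\<tau>' <\<^sub>p \<tau>"
    using \<tau> \<tau>' occ by (auto simp: pattern_less_def pattern_le_def)
  obtain f where f: "embeds \<tau>' \<tau> f" "J = f ` {..<length \<tau>'}"
    using occ unfolding occurrence_iff_embeds by blast
  show thesis
  proof (rule that[OF less occ])
    have "a \<in> B" by (simp add: Beq)
    with aJ show "B \<inter> J \<noteq> {}" by blast
    fix \<rho> e assume \<rho>: "\<rho> \<in> perms" and e: "embeds \<rho> \<tau> e"
      and one: "\<And>i j. \<lbrakk>i < length \<rho>; j < length \<rho>; e i \<in> B; e j \<in> B\<rbrakk> \<Longrightarrow> i = j"
    let ?g = "\<lambda>i. if e i \<in> B then a else e i"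
    have g: "embeds \<rho> \<tau> ?g"
      using embeds_move_into_block[OF e d Beq ab img one] .
    have "?g ` {..<length \<rho>} \<subseteq> J"
      using aJ e by (auto simp: J_def embeds_def)
    then obtain h where "embeds \<rho> \<tau>' h"
      unfolding f(2) by (rule embeds_factor[OF g f(1)])
    with \<rho> \<tau>' show "\<rho> \<le>\<^sub>p \<tau>'" unfolding pattern_le_def occurrence_iff_embeds by blast
  qed
qed

lemma mobius_eq_0_if_has_interval_block:
  assumes "\<sigma> \<le>\<^sub>p \<tau>" "has_interval_block \<sigma> \<tau>"
  shows "mobius \<sigma> \<tau> = 0"
  using assms
proof (induction "length \<tau>" arbitrary: \<tau> rule: less_induct)
  case less
  then have \<sigma>: "\<sigma> \<in> perms" and \<tau>: "\<tau> \<in> perms" by (auto simp: pattern_le_def)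
  from less.prems(2) obtain B where B: "interval_block \<tau> B"
    and disj: "\<And>I. occurrence \<sigma> \<tau> I \<Longrightarrow> B \<inter> I = {}"
    unfolding has_interval_block_def by blast
  obtain \<tau>' J where \<tau>': "\<tau>' <\<^sub>p \<tau>" and J: "occurrence \<tau>' \<tau> J" "B \<inter> J \<noteq> {}"
    and below: "\<And>\<rho> e. \<lbrakk>\<rho> \<in> perms; embeds \<rho> \<tau> e;
      \<And>i j. \<lbrakk>i < length \<rho>; j < length \<rho>; e i \<in> B; e j \<in> B\<rbrakk> \<Longrightarrow> i = j\<rbrakk> \<Longrightarrow> \<rho> \<le>\<^sub>p \<tau>'"
    by (rule collapse_block[OF \<tau> B]) blast
  obtain e where e: "embeds \<sigma> \<tau> e"
    using less.prems(1) unfolding pattern_le_def occurrence_iff_embeds by blast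
  have "B \<inter> e ` {..<length \<sigma>} = {}"
    using e by (intro disj) (auto simp: occurrence_iff_embeds)
  \<comment> \<open>The embedding of \<sigma> avoids \<open>B\<close>, so the condition of at most
    one letter there holds vacuously.\<close>
  then have "\<sigma> \<le>\<^sub>p \<tau>'" by (intro below[OF \<sigma> e]) auto
  moreover have "\<sigma> \<noteq> \<tau>'" using J disj by blast
  ultimately have \<sigma>\<tau>': "\<sigma> <\<^sub>p \<tau>'" by (simp add: pattern_less_def)
  \<comment> \<open>By antisymmetry: \<rho> equal to \<tau> would put \<tau> below \<tau>'.\<close>
  have lt_trans: "\<rho> <\<^sub>p \<tau>" if "\<rho> \<le>\<^sub>p \<tau>'" for \<rho>
    using that \<tau>' pattern_le_trans pattern_le_antisym unfolding pattern_less_def by metis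
  have zero: "mobius \<sigma> \<rho> = 0" if \<rho>: "\<sigma> \<le>\<^sub>p \<rho>" "\<rho> <\<^sub>p \<tau>" "\<not> \<rho> \<le>\<^sub>p \<tau>'" for \<rho>
  proof (rule less.hyps[OF pattern_less_length[OF \<rho>(2)] \<rho>(1)])
    have p: "\<rho> \<in> perms" using \<rho>(1) by (simp add: pattern_le_def)
    obtain f where f: "embeds \<rho> \<tau> f"
      using \<rho>(2) unfolding pattern_less_def pattern_le_def occurrence_iff_embeds by blast
    \<comment> \<open>Contrapositive of \<open>below\<close>: as \<rho> is not below \<tau>', its
      embedding has two letters in \<open>B\<close>.\<close>
    with below[OF p] \<rho>(3) obtain i j
      where "i < length \<rho>" "j < length \<rho>" "i \<noteq> j" "f i \<in> B" "f j \<in> B" by metis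
    then show "has_interval_block \<sigma> \<rho>"
      using has_interval_block_preimage[OF p permsE(2)[OF \<tau>] f B disj] by blast
  qed
  have "\<sigma> <\<^sub>p \<tau>" using \<sigma>\<tau>' lt_trans by (simp add: pattern_less_def)
  then have "mobius \<sigma> \<tau> = - (\<Sum>\<rho>\<in>{\<rho>. \<sigma> \<le>\<^sub>p \<rho> \<and> \<rho> <\<^sub>p \<tau>}. mobius \<sigma> \<rho>)"
    by (simp add: mobius.simps[of \<sigma> \<tau>] pattern_less_def)
  \<comment> \<open>Dropping the vanishing terms leaves the whole closed interval from \<sigma> to
    \<tau>'.\<close>
  also have "(\<Sum>\<rho>\<in>{\<rho>. \<sigma> \<le>\<^sub>p \<rho> \<and> \<rho> <\<^sub>p \<tau>}. mobius \<sigma> \<rho>)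
      = (\<Sum>\<rho>\<in>{\<rho>. \<sigma> \<le>\<^sub>p \<rho> \<and> \<rho> \<le>\<^sub>p \<tau>'}. mobius \<sigma> \<rho>)"
  proof (rule sum.mono_neutral_right)
    show "finite {\<rho>. \<sigma> \<le>\<^sub>p \<rho> \<and> \<rho> <\<^sub>p \<tau>}"
      by (rule finite_subset[OF _ finite_pattern_downset[of \<tau>]]) (auto simp: pattern_less_def)
  qed (use lt_trans zero in auto)
  also have "\<dots> = 0" by (rule sum_mobius_eq_0[OF \<sigma>\<tau>'])
  finally show ?case by simp
qed

theorem theorem3p2:
  fixes k n :: nat and \<sigma> \<tau> :: "nat list"
  assumes "k \<ge> 1" and "n \<ge> 1"
    and "\<sigma> \<in> perms_of_size k" and "\<tau> \<in> perms_of_size n"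
    and "\<sigma> \<le>\<^sub>p \<tau>"
    and "has_interval_block \<sigma> \<tau>"
  shows "mobius \<sigma> \<tau> = 0"
  using assms(5,6) by (rule mobius_eq_0_if_has_interval_block)

end
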